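(* Let $(M,K)$ be an $n$-dimensional $m$-th root Cartan space, $m\ge3$, with $\mathbf H$-curvature $\mathbf H=(H^{ij})$ and angular metric $\mathbf h=(h^{ij})$. Suppose that $K$ has almost vanishing $\mathbf H$-curvature, i.e. there is a 1-form $\theta=\theta^i(x)p_i$ on $M$ such that $$H^{ij}=\frac{n+1}{2}\,K^{-1}\,\theta\, h^{ij}\qquad\text{on } T^*M\setminus\{0\}\ \text{ for all } i,j .$$ Then $\mathbf H=0$, i.e. $H^{ij}=0$ for all $i,j$.
   Context: Let $M$ be an $n$-dimensional smooth manifold and $T^*M_0=T^*M\setminus\{0\}$. Local coordinates on $T^*M$ are written $(x,p)=(x_i,p_i)$; write $\partial^i=\partial/\partial x_i$ and $\dot\partial^i=\partial/\partial p_i$. Repeated indices are summed. All local quantities below are defined by their formulas in the charts of a fixed atlas of $M$, and identities between them are understood in these coordinates. In this setting "a 1-form on $M$" means a function on $T^*M$ that is linear in $p$, of the form $\theta=\theta^i(x)p_i$. A Cartan space $(M,K)$ is given by a positive function $K(x,p)$, smooth on $T^*M_0$, continuous on the zero section, positively $1$-homogeneous in $p$, such that $g^{ij}(x,p)=\frac12\dot\partial^i\dot\partial^jK^2$ is positive definite on $T^*M_0$. It is an $m$-th root Cartan space ($m\ge3$ an integer) if $$K(x,p)=\sqrt[m]{a^{i_1\dots i_m}(x)p_{i_1}\cdots p_{i_m}},$$ with (smooth) coefficients $a^{i_1\dots i_m}(x)$ depending only on $x$ and symmetric in all indices. Put $a^{ij}(x,p)=K^{-(m-2)}a^{iji_3\dots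 i_m}(x)p_{i_3}\cdots p_{i_m}$; the matrix $(a^{ij})$ is invertible. Generalized Christoffel symbols: $$\{i_1\dots i_m,j\}=\tfrac1{2(m-1)}\big(\partial^{i_1}a^{i_2\dots i_mj}+\partial^{i_2}a^{i_3\dots i_mi_1j}+\dots+\partial^{i_m}a^{i_1\dots i_{m-1}j}-\partial^ja^{i_1\dots i_m}\big),$$ and $\{00\dots0,h\}=\{i_1\dots i_m,h\}p_{i_1}\cdots p_{i_m}$. The spray coefficients $G_r(x,p)$ (geodesics: $\ddot x_i+2G_i(x,\dot x)=0$) are the unique solution of $a^{hr}G_r=\frac{1}{mK^{m-2}}\{00\dots0,h\}$. Put $G^i_r=\dot\partial^iG_r$, $G^{ij}_r=\dot\partial^jG^i_r$ (coefficients of the Berwald connection), $G^{ijk}_r=\dot\partial^kG^{ij}_r$ (Berwald curvature). Mean Berwald curvature: $E^{ij}=\frac12G^{rij}_r$. $\mathbf H$-curvature: $H^{ij}=E^{ij|s}p_s$, where $|$ is the horizontal covariant derivative of the Berwald connection, $E^{ij|s}=\partial^sE^{ij}-G^s_r\dot\partial^rE^{ij}-E^{rj}G^{is}_r-E^{ir}G^{js}_r$; explicitly $H^{ij}=p_s\partial^sE^{ij}-2G_r\dot\partial^rE^{ij}-E^{rj}G^i_r-E^{ir}G^j_r$. Angular metric: $h^{ij}=K\,\dot\partial^i\dot\partial^jK$. *)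

theory Defs
  imports "HOL-Analysis.Analysis"
begin

section \<open>Smooth functions and partial derivatives\<close>

text \<open>Both notions are meant for open \<open>S\<close>; \<open>smooth_on\<close> is \<open>C\<^sup>\<infinity>\<close>.\<close>

primrec k_times_differentiable_on ::
  "nat \<Rightarrow> ('a::real_normed_vector \<Rightarrow> 'b::real_normed_vector) \<Rightarrow> 'a set \<Rightarrow> bool" where
  "k_times_differentiable_on 0 f S \<longleftrightarrow> continuous_on S f"
| "k_times_differentiable_on (Suc k) f S \<longleftrightarrow>
     (\<forall>x\<in>S. f differentiable (at x)) \<and>
     (\<forall>v. k_times_differentiable_on k (\<lambda>x. frechet_derivative f (at x) v) S)"

definition smooth_on :: "('a::real_normed_vector \<Rightarrow> 'b::real_normed_vector) \<Rightarrow> 'a set \<Rightarrow> bool" where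
  "smooth_on f S \<longleftrightarrow> (\<forall>k. k_times_differentiable_on k f S)"

definition partial :: "'n \<Rightarrow> (real^'n \<Rightarrow> real) \<Rightarrow> real^'n \<Rightarrow> real" where
  "partial i f x = deriv (\<lambda>t. f (x + t *\<^sub>R axis i 1)) 0"

section \<open>Smooth manifolds and the cotangent bundle\<close>

text \<open>A chart is a pair of its domain and its coordinate map; the values of the coordinate map
  outside the domain are irrelevant. The dimension is \<open>n = CARD('n)\<close>.\<close>

type_synonym ('a, 'n) chart = "'a set \<times> ('a \<Rightarrow> real^'n)"

definition chart_inv :: "('a, 'n) chart \<Rightarrow> real^'n \<Rightarrow> 'a" where
  "chart_inv c = inv_into (fst c) (snd c)"

definition smooth_atlas :: "'a topology \<Rightarrow> ('a, 'n::finite) chart set \<Rightarrow> bool" where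
  "smooth_atlas M \<A> \<longleftrightarrow>
     (\<forall>c\<in>\<A>. openin M (fst c) \<and> open (snd c ` fst c) \<and>
        homeomorphic_map (subtopology M (fst c)) (top_of_set (snd c ` fst c)) (snd c)) \<and>
     (\<Union>c\<in>\<A>. fst c) = topspace M \<and>
     (\<forall>c\<in>\<A>. \<forall>d\<in>\<A>. smooth_on (\<lambda>x. snd d (chart_inv c x)) (snd c ` (fst c \<inter> fst d)))"

definition smooth_manifold :: "'a topology \<Rightarrow> ('a, 'n::finite) chart set \<Rightarrow> bool" where
  "smooth_manifold M \<A> \<longleftrightarrow> Hausdorff_space M \<and> second_countable M \<and> smooth_atlas M \<A>"

text \<open>A cotangent vector at a point \<open>q\<close> is given by its components \<open>\<omega> c\<close> in every chart \<open>c\<close>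
  around \<open>q\<close>, subject to the transformation law \<open>p\<^sub>i = (\<partial>y\<^sub>j/\<partial>x\<^sub>i) p'\<^sub>j\<close>. For all other \<open>c\<close> the
  value \<open>\<omega> c\<close> is normalised to \<open>0\<close>, so that equality of cotangent vectors is equality of pairs.\<close>

type_synonym ('a, 'n) covector = "'a \<times> (('a, 'n) chart \<Rightarrow> real^'n)"

definition cotangent_bundle ::
  "'a topology \<Rightarrow> ('a, 'n::finite) chart set \<Rightarrow> ('a, 'n) covector set" where
  "cotangent_bundle M \<A> = {(q, \<omega>). q \<in> topspace M \<and>
     (\<forall>c. c \<notin> \<A> \<or> q \<notin> fst c \<longrightarrow> \<omega> c = 0) \<and>
     (\<forall>c\<in>\<A>. \<forall>d\<in>\<A>. q \<in> fst c \<inter> fst d \<longrightarrow>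
        (\<forall>i. \<omega> c $ i = (\<Sum>j\<in>UNIV. partial i (\<lambda>x. snd d (chart_inv c x) $ j) (snd c q) * \<omega> d $ j)))}"

definition slit_cotangent_bundle ::
  "'a topology \<Rightarrow> ('a, 'n::finite) chart set \<Rightarrow> ('a, 'n) covector set" where
  "slit_cotangent_bundle M \<A> = {(q, \<omega>) \<in> cotangent_bundle M \<A>. \<omega> \<noteq> (\<lambda>c. 0)}"

text \<open>The chart of \<open>T\<^sup>*M\<close> induced by \<open>c\<close> is \<open>(q, \<omega>) \<mapsto> (snd c q, \<omega> c)\<close>;
  \<open>in_chart M \<A> c F\<close> is the expression \<open>F(x,p)\<close> of a function \<open>F\<close> on \<open>T\<^sup>*M\<close> in it.\<close>

definition in_chart :: "'a topology \<Rightarrow> ('a, 'n::finite) chart set \<Rightarrow> ('a, 'n) chart \<Rightarrow>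
    (('a, 'n) covector \<Rightarrow> real) \<Rightarrow> real^'n \<Rightarrow> real^'n \<Rightarrow> real" where
  "in_chart M \<A> c F x p =
     F (inv_into {(q, \<omega>) \<in> cotangent_bundle M \<A>. q \<in> fst c} (\<lambda>(q, \<omega>). (snd c q, \<omega> c)) (x, p))"

text \<open>A 1-form is a function on \<open>T\<^sup>*M\<close> that is linear in \<open>p\<close>.\<close>

definition one_form ::
  "'a topology \<Rightarrow> ('a, 'n::finite) chart set \<Rightarrow> (('a, 'n) covector \<Rightarrow> real) \<Rightarrow> bool" where
  "one_form M \<A> \<theta> \<longleftrightarrow>
     (\<forall>c\<in>\<A>. \<exists>t :: 'n \<Rightarrow> real^'n \<Rightarrow> real. \<forall>x \<in> snd c ` fst c. \<forall>p.
        in_chart M \<A> c \<theta> x p = (\<Sum>i\<in>UNIV. t i x * p $ i))"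

section \<open>Local quantities on phase space\<close>

type_synonym 'n phase_fun = "real^'n \<Rightarrow> real^'n \<Rightarrow> real"

definition dx :: "'n::finite \<Rightarrow> 'n phase_fun \<Rightarrow> 'n phase_fun" where
  "dx i f x p = partial i (\<lambda>y. f y p) x"

definition dp :: "'n::finite \<Rightarrow> 'n phase_fun \<Rightarrow> 'n phase_fun" where
  "dp i f x p = partial i (\<lambda>q. f x q) p"

definition metric_tensor :: "'n::finite phase_fun \<Rightarrow> 'n \<Rightarrow> 'n \<Rightarrow> 'n phase_fun" where
  "metric_tensor K i j x p = 1/2 * dp i (dp j (\<lambda>x p. (K x p)\<^sup>2)) x p"

definition angular_metric :: "'n::finite phase_fun \<Rightarrow> 'n \<Rightarrow> 'n \<Rightarrow> 'n phase_fun" where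
  "angular_metric K i j x p = K x p * dp i (dp j K) x p"

text \<open>The coefficient of an \<open>m\<close>-th root metric with upper indices \<open>i1, ..., im\<close> is
  \<open>a [i1, ..., im] x\<close>; only lists of length \<open>m\<close> matter.\<close>

type_synonym 'n coeffs = "'n list \<Rightarrow> real^'n \<Rightarrow> real"

definition monomial :: "'n list \<Rightarrow> real^'n \<Rightarrow> real" where
  "monomial is p = (\<Prod>i\<leftarrow>is. p $ i)"

definition root_form :: "nat \<Rightarrow> 'n::finite coeffs \<Rightarrow> 'n phase_fun" where
  "root_form m a x p = (\<Sum>is | length is = m. a is x * monomial is p)"

definition a2 :: "nat \<Rightarrow> 'n::finite coeffs \<Rightarrow> 'n phase_fun \<Rightarrow> 'n \<Rightarrow> 'n \<Rightarrow> 'n phase_fun" where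
  "a2 m a K i j x p =
     inverse (K x p ^ (m - 2)) * (\<Sum>is | length is = m - 2. a (i # j # is) x * monomial is p)"

text \<open>With \<open>is = [i1, ..., im]\<close>, the list \<open>tl (rotate k is)\<close> consists of the indices following
  \<open>is ! k\<close> cyclically.\<close>

definition christoffel :: "nat \<Rightarrow> 'n::finite coeffs \<Rightarrow> 'n list \<Rightarrow> 'n \<Rightarrow> real^'n \<Rightarrow> real" where
  "christoffel m a is j x = 1 / (2 * (real m - 1)) *
     ((\<Sum>k<m. partial (is ! k) (a (tl (rotate k is) @ [j])) x) - partial j (a is) x)"

definition christoffel0 :: "nat \<Rightarrow> 'n::finite coeffs \<Rightarrow> 'n \<Rightarrow> 'n phase_fun" where
  "christoffel0 m a h x p = (\<Sum>is | length is = m. christoffel m a is h x * monomial is p)"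

definition spray :: "nat \<Rightarrow> 'n::finite coeffs \<Rightarrow> 'n phase_fun \<Rightarrow> real^'n \<Rightarrow> real^'n \<Rightarrow> real^'n" where
  "spray m a K x p = (THE G. \<forall>h. (\<Sum>r\<in>UNIV. a2 m a K h r x p * G $ r) =
     1 / (real m * K x p ^ (m - 2)) * christoffel0 m a h x p)"

text \<open>\<open>G0 m a K r\<close>, \<open>G1 m a K r i\<close>, \<open>G2 m a K r i j\<close>, \<open>G3 m a K r i j k\<close> stand for
  \<open>G\<^sub>r\<close>, \<open>G\<^sup>i\<^sub>r\<close>, \<open>G\<^sup>i\<^sup>j\<^sub>r\<close>, \<open>G\<^sup>i\<^sup>j\<^sup>k\<^sub>r\<close>.\<close>

definition G0 :: "nat \<Rightarrow> 'n::finite coeffs \<Rightarrow> 'n phase_fun \<Rightarrow> 'n \<Rightarrow> 'n phase_fun" where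
  "G0 m a K r x p = spray m a K x p $ r"

definition G1 :: "nat \<Rightarrow> 'n::finite coeffs \<Rightarrow> 'n phase_fun \<Rightarrow> 'n \<Rightarrow> 'n \<Rightarrow> 'n phase_fun" where
  "G1 m a K r i = dp i (G0 m a K r)"

definition G2 :: "nat \<Rightarrow> 'n::finite coeffs \<Rightarrow> 'n phase_fun \<Rightarrow> 'n \<Rightarrow> 'n \<Rightarrow> 'n \<Rightarrow> 'n phase_fun" where
  "G2 m a K r i j = dp j (G1 m a K r i)"

definition G3 ::
  "nat \<Rightarrow> 'n::finite coeffs \<Rightarrow> 'n phase_fun \<Rightarrow> 'n \<Rightarrow> 'n \<Rightarrow> 'n \<Rightarrow> 'n \<Rightarrow> 'n phase_fun" where
  "G3 m a K r i j k = dp k (G2 m a K r i j)"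

definition mean_berwald ::
  "nat \<Rightarrow> 'n::finite coeffs \<Rightarrow> 'n phase_fun \<Rightarrow> 'n \<Rightarrow> 'n \<Rightarrow> 'n phase_fun" where
  "mean_berwald m a K i j x p = 1/2 * (\<Sum>r\<in>UNIV. G3 m a K r r i j x p)"

definition mean_berwald_cov ::
  "nat \<Rightarrow> 'n::finite coeffs \<Rightarrow> 'n phase_fun \<Rightarrow> 'n \<Rightarrow> 'n \<Rightarrow> 'n \<Rightarrow> 'n phase_fun" where
  "mean_berwald_cov m a K i j s x p =
     dx s (mean_berwald m a K i j) x p
     - (\<Sum>r\<in>UNIV. G1 m a K r s x p * dp r (mean_berwald m a K i j) x p)
     - (\<Sum>r\<in>UNIV. mean_berwald m a K r j x p * G2 m a K r i s x p)
     - (\<Sum>r\<in>UNIV. mean_berwald m a K i r x p * G2 m a K r j s x p)"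

definition H_curvature ::
  "nat \<Rightarrow> 'n::finite coeffs \<Rightarrow> 'n phase_fun \<Rightarrow> 'n \<Rightarrow> 'n \<Rightarrow> 'n phase_fun" where
  "H_curvature m a K i j x p = (\<Sum>s\<in>UNIV. mean_berwald_cov m a K i j s x p * p $ s)"

section \<open>Cartan spaces\<close>

definition cartan_space ::
  "'a topology \<Rightarrow> ('a, 'n::finite) chart set \<Rightarrow> (('a, 'n) covector \<Rightarrow> real) \<Rightarrow> bool" where
  "cartan_space M \<A> K \<longleftrightarrow> smooth_manifold M \<A> \<and>
     (\<forall>\<xi>\<in>slit_cotangent_bundle M \<A>. K \<xi> > 0) \<and>
     (\<forall>c\<in>\<A>. smooth_on (\<lambda>(x, p). in_chart M \<A> c K x p) ((snd c ` fst c) \<times> (- {0}))) \<and>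
     (\<forall>c\<in>\<A>. \<forall>x \<in> snd c ` fst c. isCont (\<lambda>(x, p). in_chart M \<A> c K x p) (x, 0)) \<and>
     (\<forall>(q, \<omega>)\<in>cotangent_bundle M \<A>. \<forall>t>0. K (q, \<lambda>c. t *\<^sub>R \<omega> c) = t * K (q, \<omega>)) \<and>
     (\<forall>c\<in>\<A>. \<forall>x \<in> snd c ` fst c. \<forall>p. p \<noteq> 0 \<longrightarrow> (\<forall>v :: real^'n. v \<noteq> 0 \<longrightarrow>
        (\<Sum>i\<in>UNIV. \<Sum>j\<in>UNIV. metric_tensor (in_chart M \<A> c K) i j x p * v $ i * v $ j) > 0))"

text \<open>\<open>a c\<close> are the coefficients of \<open>K\<^sup>m\<close> in the chart \<open>c\<close>; being symmetric, they are
  determined by \<open>K\<close> on the image of \<open>c\<close>.\<close>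

definition mth_root_cartan_space :: "'a topology \<Rightarrow> ('a, 'n::finite) chart set \<Rightarrow>
    (('a, 'n) covector \<Rightarrow> real) \<Rightarrow> nat \<Rightarrow> (('a, 'n) chart \<Rightarrow> 'n coeffs) \<Rightarrow> bool" where
  "mth_root_cartan_space M \<A> K m a \<longleftrightarrow> cartan_space M \<A> K \<and> m \<ge> 3 \<and>
     (\<forall>c\<in>\<A>.
        (\<forall>is. length is = m \<longrightarrow> smooth_on (a c is) (snd c ` fst c)) \<and>
        (\<forall>is js. length is = m \<and> mset js = mset is \<longrightarrow>
           (\<forall>x \<in> snd c ` fst c. a c js x = a c is x)) \<and>
        (\<forall>x \<in> snd c ` fst c. \<forall>p.
           in_chart M \<A> c K x p = root m (root_form m (a c) x p)))"

definition almost_vanishing_H_curvature :: "'a topology \<Rightarrow> ('a, 'n::finite) chart set \<Rightarrow>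
    (('a, 'n) covector \<Rightarrow> real) \<Rightarrow> nat \<Rightarrow> (('a, 'n) chart \<Rightarrow> 'n coeffs) \<Rightarrow> bool" where
  "almost_vanishing_H_curvature M \<A> K m a \<longleftrightarrow> (\<exists>\<theta>. one_form M \<A> \<theta> \<and>
     (\<forall>c\<in>\<A>. \<forall>x \<in> snd c ` fst c. \<forall>p. p \<noteq> 0 \<longrightarrow> (\<forall>i j.
        H_curvature m (a c) (in_chart M \<A> c K) i j x p =
          (real CARD('n) + 1) / 2 * inverse (in_chart M \<A> c K x p) * in_chart M \<A> c \<theta> x p *
          angular_metric (in_chart M \<A> c K) i j x p)))"

definition vanishing_H_curvature :: "'a topology \<Rightarrow> ('a, 'n::finite) chart set \<Rightarrow>
    (('a, 'n) covector \<Rightarrow> real) \<Rightarrow> nat \<Rightarrow> (('a, 'n) chart \<Rightarrow> 'n coeffs) \<Rightarrow> bool" where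
  "vanishing_H_curvature M \<A> K m a \<longleftrightarrow>
     (\<forall>c\<in>\<A>. \<forall>x \<in> snd c ` fst c. \<forall>p. p \<noteq> 0 \<longrightarrow> (\<forall>i j.
        H_curvature m (a c) (in_chart M \<A> c K) i j x p = 0))"

end

theory Submission
  imports Defs
begin

text \<open>Both sides of the hypothesis have a parity in \<open>p\<close>. The spray is even in \<open>p\<close>, so \<open>E\<close> is odd and
  \<open>\<^bold>H\<close> is even. In dimension at least 2 the punctured fibre is connected and \<open>K\<close> has no zero on it,
  which forces \<open>m\<close> to be even; then \<open>K\<close> and the angular metric are even, whereas \<open>\<theta>\<close> is odd, so
  that \<open>\<^bold>H\<close> is also odd. In dimension 1 with \<open>m\<close> odd, \<open>K\<close> is linear in \<open>p\<close> and the angular metric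
  vanishes. The parity of a derivative is only meaningful where the derivative exists (otherwise
  \<open>deriv\<close> is arbitrary), so joint smoothness of the spray in \<open>(x, p)\<close> is needed; it follows from
  Cramer's rule once \<open>(a\<^sup>i\<^sup>j)\<close> is known to be invertible.\<close>

section \<open>Closure properties of smooth functions\<close>

lemma k_times_differentiable_onD:
  assumes "k_times_differentiable_on (Suc k) f S" "x \<in> S"
  shows "(f has_derivative frechet_derivative f (at x)) (at x)"
  using assms by (auto simp: frechet_derivative_works)

text \<open>On an open set the derivative at a point depends only on nearby values, so
  \<open>f\<close> and \<open>g\<close> share it and the induction passes to the
  derivatives.\<close>

lemma k_times_differentiable_on_cong:
  assumes "open S" "\<And>x. x \<in> S \<Longrightarrow> f x = g x" "k_times_differentiable_on k f S"
  shows "k_times_differentiable_on k g S"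
  using assms(2,3)
proof (induction k arbitrary: f g)
  case 0
  then show ?case using continuous_on_cong[of S S f g] by simp
next
  case (Suc k)
  have D: "(g has_derivative frechet_derivative f (at x)) (at x)" if "x \<in> S" for x
    by (rule has_derivative_transform_within_open[OF k_times_differentiable_onD[OF Suc.prems(2) that]
          assms(1) that]) (auto simp: Suc.prems)
  have "k_times_differentiable_on k (\<lambda>x. frechet_derivative g (at x) v) S" for v
  proof (rule Suc.IH[of "\<lambda>x. frechet_derivative f (at x) v"])
    show "frechet_derivative f (at x) v = frechet_derivative g (at x) v" if "x \<in> S" for x
      using frechet_derivative_at[OF D[OF that]] by simp
  qed (use Suc.prems(2) in simp)
  then show ?case using D by (auto simp: differentiable_def)
qed

text \<open>By uniqueness of the derivative, any explicit \<open>f'\<close> may stand in for the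
  chosen \<open>frechet_derivative\<close>. The closure lemmas below feed the usual differentiation
  rules into this form.\<close>

lemma k_times_differentiable_on_SucI:
  assumes "open S" "\<And>x. x \<in> S \<Longrightarrow> (f has_derivative f' x) (at x)"
    and "\<And>v. k_times_differentiable_on k (\<lambda>x. f' x v) S"
  shows "k_times_differentiable_on (Suc k) f S"
proof -
  have "k_times_differentiable_on k (\<lambda>x. frechet_derivative f (at x) v) S" for v
    by (rule k_times_differentiable_on_cong[OF assms(1) _ assms(3)])
      (simp add: frechet_derivative_at[OF assms(2), symmetric])
  then show ?thesis using assms(2) by (auto simp: differentiable_def)
qed

lemma k_times_differentiable_on_Suc_imp:
  "k_times_differentiable_on (Suc k) f S \<Longrightarrow> k_times_differentiable_on k f S"
proof (induction k arbitrary: f)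
  case 0
  then show ?case
    by (auto intro!: continuous_at_imp_continuous_on differentiable_imp_continuous_within)
qed simp

lemma k_times_differentiable_on_const:
  assumes "open S" shows "k_times_differentiable_on k (\<lambda>x. c) S"
proof (induction k arbitrary: c)
  case (Suc k)
  show ?case
    by (rule k_times_differentiable_on_SucI[OF assms, where f' = "\<lambda>_ _. 0"]) (auto simp: Suc)
qed simp

lemma k_times_differentiable_on_add:
  assumes "open S" "k_times_differentiable_on k f S" "k_times_differentiable_on k g S"
  shows "k_times_differentiable_on k (\<lambda>x. f x + g x) S"
  using assms(2,3)
proof (induction k arbitrary: f g)
  case (Suc k)
  show ?case
    by (rule k_times_differentiable_on_SucI[OF assms(1)
          has_derivative_add[OF Suc.prems[THEN k_times_differentiable_onD]]])
      (use Suc in auto)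
qed (auto intro: continuous_on_add)

lemma k_times_differentiable_on_mult:
  fixes f g :: "'a::real_normed_vector \<Rightarrow> 'b::real_normed_algebra"
  assumes "open S" "k_times_differentiable_on k f S" "k_times_differentiable_on k g S"
  shows "k_times_differentiable_on k (\<lambda>x. f x * g x) S"
  using assms(2,3)
proof (induction k arbitrary: f g)
  case (Suc k)
  have lower: "k_times_differentiable_on k f S" "k_times_differentiable_on k g S"
    using Suc.prems[THEN k_times_differentiable_on_Suc_imp] .
  have "k_times_differentiable_on k
      (\<lambda>x. f x * frechet_derivative g (at x) v + frechet_derivative f (at x) v * g x) S" for v
    by (intro k_times_differentiable_on_add[OF assms(1)] Suc.IH lower) (use Suc.prems in simp_all)
  from k_times_differentiable_on_SucI[OF assms(1)
      has_derivative_mult[OF Suc.prems[THEN k_times_differentiable_onD]] this]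
  show ?case .
qed (auto intro: continuous_on_mult)

text \<open>The derivative of \<open>inverse f\<close> is a product of \<open>inverse f\<close> and
  the derivative of \<open>f\<close>, so order \<open>k\<close> for \<open>inverse f\<close> itself
  yields order \<open>Suc k\<close>.\<close>

lemma k_times_differentiable_on_inverse:
  fixes f :: "'a::real_normed_vector \<Rightarrow> 'b::real_normed_div_algebra"
  assumes "open S" "\<And>x. x \<in> S \<Longrightarrow> f x \<noteq> 0" "k_times_differentiable_on k f S"
  shows "k_times_differentiable_on k (\<lambda>x. inverse (f x)) S"
  using assms(3)
proof (induction k)
  case 0
  then show ?case using assms(2) by (auto intro: continuous_on_inverse)
next
  case (Suc k)
  note mult = k_times_differentiable_on_mult[OF assms(1)]
  have inv: "k_times_differentiable_on k (\<lambda>x. inverse (f x)) S"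
    using Suc.IH k_times_differentiable_on_Suc_imp[OF Suc.prems] .
  have neg: "k_times_differentiable_on k (\<lambda>x. - 1 * h x) S"
    if "k_times_differentiable_on k h S" for h :: "'a \<Rightarrow> 'b"
    by (intro mult k_times_differentiable_on_const assms(1) that)
  show ?case
  proof (rule k_times_differentiable_on_SucI[OF assms(1)])
    show "((\<lambda>x. inverse (f x)) has_derivative
        (\<lambda>v. - (inverse (f x) * frechet_derivative f (at x) v * inverse (f x)))) (at x)"
      if "x \<in> S" for x
      using Deriv.has_derivative_inverse[OF assms(2)[OF that] k_times_differentiable_onD[OF Suc.prems that]] .
    show "k_times_differentiable_on k
        (\<lambda>x. - (inverse (f x) * frechet_derivative f (at x) v * inverse (f x))) S" for v
      using neg[OF mult[OF mult[OF inv, of "\<lambda>x. frechet_derivative f (at x) v"] inv]] Suc.prems by simp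
  qed
qed

text \<open>The derivative along \<open>v\<close> is the derivative of \<open>f\<close> in the fixed
  direction \<open>L v\<close>, again composed with \<open>L\<close>, so the induction closes. Used
  with the projection \<open>fst\<close> to regard functions of \<open>x\<close> as functions of
  \<open>(x, p)\<close>.\<close>

lemma k_times_differentiable_on_compose_linear:
  assumes "bounded_linear L" "open T" "L ` T \<subseteq> S" "k_times_differentiable_on k f S"
  shows "k_times_differentiable_on k (\<lambda>x. f (L x)) T"
  using assms(4)
proof (induction k arbitrary: f)
  case 0
  then show ?case
    using continuous_on_compose2[OF _ linear_continuous_on[OF assms(1)] assms(3)] by simp
next
  case (Suc k)
  show ?case
  proof (rule k_times_differentiable_on_SucI[OF assms(2)])
    show "((\<lambda>x. f (L x)) has_derivative (\<lambda>v. frechet_derivative f (at (L x)) (L v))) (at x)"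
      if "x \<in> T" for x
      by (rule has_derivative_compose[OF bounded_linear_imp_has_derivative[OF assms(1)]])
        (rule k_times_differentiable_onD[OF Suc.prems], use that assms(3) in auto)
  qed (use Suc in auto)
qed

lemma k_times_differentiable_on_linear:
  assumes "bounded_linear L" "open S"
  shows "k_times_differentiable_on k L S"
proof (cases k)
  case 0
  then show ?thesis using linear_continuous_on[OF assms(1)] by simp
next
  case (Suc l)
  then show ?thesis
    using k_times_differentiable_on_SucI[OF assms(2) bounded_linear_imp_has_derivative[OF assms(1)]
        k_times_differentiable_on_const[OF assms(2)]] by simp
qed

section \<open>Smoothness of all orders\<close>

lemma smooth_on_has_derivative:
  "smooth_on f S \<Longrightarrow> x \<in> S \<Longrightarrow> (f has_derivative frechet_derivative f (at x)) (at x)"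
  unfolding smooth_on_def using k_times_differentiable_onD by blast

lemma smooth_on_frechet_derivative:
  assumes "smooth_on f S" shows "smooth_on (\<lambda>x. frechet_derivative f (at x) v) S"
  using assms unfolding smooth_on_def by (metis k_times_differentiable_on.simps(2))

lemma smooth_on_cong:
  "open S \<Longrightarrow> smooth_on f S \<Longrightarrow> (\<And>x. x \<in> S \<Longrightarrow> f x = g x) \<Longrightarrow> smooth_on g S"
  unfolding smooth_on_def using k_times_differentiable_on_cong by blast

lemma smooth_on_const: "open S \<Longrightarrow> smooth_on (\<lambda>x. c) S"
  unfolding smooth_on_def using k_times_differentiable_on_const by blast

lemma smooth_on_add: "open S \<Longrightarrow> smooth_on f S \<Longrightarrow> smooth_on g S \<Longrightarrow> smooth_on (\<lambda>x. f x + g x) S"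
  unfolding smooth_on_def using k_times_differentiable_on_add by blast

lemma smooth_on_mult:
  fixes f g :: "'a::real_normed_vector \<Rightarrow> 'b::real_normed_algebra"
  shows "open S \<Longrightarrow> smooth_on f S \<Longrightarrow> smooth_on g S \<Longrightarrow> smooth_on (\<lambda>x. f x * g x) S"
  unfolding smooth_on_def using k_times_differentiable_on_mult by blast

lemma smooth_on_inverse:
  fixes f :: "'a::real_normed_vector \<Rightarrow> 'b::real_normed_div_algebra"
  shows "open S \<Longrightarrow> smooth_on f S \<Longrightarrow> (\<And>x. x \<in> S \<Longrightarrow> f x \<noteq> 0) \<Longrightarrow> smooth_on (\<lambda>x. inverse (f x)) S"
  unfolding smooth_on_def using k_times_differentiable_on_inverse by blast

lemma smooth_on_divide:
  fixes f :: "'a::real_normed_vector \<Rightarrow> 'b::real_normed_field"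
  shows "open S \<Longrightarrow> smooth_on f S \<Longrightarrow> smooth_on g S \<Longrightarrow> (\<And>x. x \<in> S \<Longrightarrow> g x \<noteq> 0) \<Longrightarrow>
    smooth_on (\<lambda>x. f x / g x) S"
  unfolding divide_inverse by (intro smooth_on_mult smooth_on_inverse)

lemma smooth_on_diff:
  fixes f :: "'a::real_normed_vector \<Rightarrow> 'b::real_normed_algebra_1"
  assumes "open S" "smooth_on f S" "smooth_on g S"
  shows "smooth_on (\<lambda>x. f x - g x) S"
  using smooth_on_add[OF assms(1,2) smooth_on_mult[OF assms(1) smooth_on_const[OF assms(1), of "- 1"]
        assms(3)]] by simp

lemma smooth_on_sum:
  "open S \<Longrightarrow> (\<And>i. i \<in> I \<Longrightarrow> smooth_on (f i) S) \<Longrightarrow> smooth_on (\<lambda>x. \<Sum>i\<in>I. f i x) S"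
  by (induction I rule: infinite_finite_induct) (auto intro: smooth_on_const smooth_on_add)

lemma smooth_on_prod:
  fixes f :: "'i \<Rightarrow> 'a::real_normed_vector \<Rightarrow> 'b::real_normed_field"
  shows "open S \<Longrightarrow> (\<And>i. i \<in> I \<Longrightarrow> smooth_on (f i) S) \<Longrightarrow> smooth_on (\<lambda>x. \<Prod>i\<in>I. f i x) S"
  by (induction I rule: infinite_finite_induct) (auto intro: smooth_on_const smooth_on_mult)

lemma smooth_on_prod_list:
  fixes f :: "'i \<Rightarrow> 'a::real_normed_vector \<Rightarrow> 'b::real_normed_algebra_1"
  shows "open S \<Longrightarrow> (\<And>i. smooth_on (f i) S) \<Longrightarrow> smooth_on (\<lambda>x. \<Prod>i\<leftarrow>is. f i x) S"
  by (induction "is") (auto intro: smooth_on_const smooth_on_mult)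

lemma smooth_on_power:
  fixes f :: "'a::real_normed_vector \<Rightarrow> 'b::real_normed_algebra_1"
  shows "open S \<Longrightarrow> smooth_on f S \<Longrightarrow> smooth_on (\<lambda>x. f x ^ k) S"
  by (induction k) (auto intro: smooth_on_const smooth_on_mult)

lemma smooth_on_linear: "bounded_linear L \<Longrightarrow> open S \<Longrightarrow> smooth_on L S"
  unfolding smooth_on_def using k_times_differentiable_on_linear by blast

lemma smooth_on_compose_linear:
  "bounded_linear L \<Longrightarrow> open T \<Longrightarrow> L ` T \<subseteq> S \<Longrightarrow> smooth_on f S \<Longrightarrow> smooth_on (\<lambda>x. f (L x)) T"
  unfolding smooth_on_def using k_times_differentiable_on_compose_linear by blast

text \<open>The Leibniz formula makes the determinant a polynomial in the entries.\<close>

lemma smooth_on_det: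
  fixes A :: "'a::real_normed_vector \<Rightarrow> real^'n^'n"
  assumes "open S" "\<And>i j. smooth_on (\<lambda>x. A x $ i $ j) S"
  shows "smooth_on (\<lambda>x. det (A x)) S"
  unfolding det_def by (intro smooth_on_sum smooth_on_mult smooth_on_prod smooth_on_const assms)

text \<open>Partial derivatives are defined by \<open>deriv\<close> along coordinate lines; the
  chain rule along a line ties them to the Frechet derivative.\<close>

lemma smooth_on_DERIV:
  fixes f :: "'a::real_normed_vector \<Rightarrow> real"
  assumes "smooth_on f S" "x \<in> S"
  shows "((\<lambda>t. f (x + t *\<^sub>R v)) has_real_derivative frechet_derivative f (at x) v) (at 0)"
proof -
  have f: "(f has_derivative frechet_derivative f (at x)) (at (x + 0 *\<^sub>R v))"
    using smooth_on_has_derivative[OF assms] by simp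
  have "((\<lambda>t. x + t *\<^sub>R v) has_derivative (\<lambda>t. t *\<^sub>R v)) (at 0)"
    by (auto intro!: derivative_eq_intros)
  from has_derivative_compose[OF this f]
  have "((\<lambda>t. f (x + t *\<^sub>R v)) has_derivative (\<lambda>t. frechet_derivative f (at x) (t *\<^sub>R v))) (at 0)" .
  moreover have "frechet_derivative f (at x) (t *\<^sub>R v) = frechet_derivative f (at x) v * t" for t
    using linear_cmul[OF has_derivative_linear[OF smooth_on_has_derivative[OF assms]]] by simp
  ultimately show ?thesis by (simp add: has_field_derivative_def)
qed

section \<open>Partial derivatives on phase space\<close>

lemma partial_eq_frechet_derivative:
  assumes "smooth_on f S" "x \<in> S"
  shows "partial i f x = frechet_derivative f (at x) (axis i 1)"
  unfolding partial_def by (rule DERIV_imp_deriv[OF smooth_on_DERIV[OF assms]])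

lemma smooth_on_partial:
  assumes "open S" "smooth_on f S" shows "smooth_on (partial i f) S"
  by (rule smooth_on_cong[OF assms(1) smooth_on_frechet_derivative[OF assms(2), of "axis i 1"]])
    (simp add: partial_eq_frechet_derivative[OF assms(2)])

context
  fixes f :: "'n::finite phase_fun" and S :: "((real^'n) \<times> (real^'n)) set"
  assumes f: "smooth_on (\<lambda>(x, p). f x p) S"
begin

text \<open>Joint smoothness turns the derivative in \<open>p\<close> with \<open>x\<close> frozen
  into a directional derivative on the product. That is again jointly smooth, so derivatives can be
  iterated.\<close>

lemma dp_eq_frechet_derivative:
  assumes "(x, p) \<in> S"
  shows "dp i f x p = frechet_derivative (\<lambda>(x, p). f x p) (at (x, p)) (0, axis i 1)"
  unfolding dp_def partial_def
  using DERIV_imp_deriv[OF smooth_on_DERIV[OF f assms, of "(0, axis i 1)"]] by simp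

lemma dx_eq_frechet_derivative:
  assumes "(x, p) \<in> S"
  shows "dx i f x p = frechet_derivative (\<lambda>(x, p). f x p) (at (x, p)) (axis i 1, 0)"
  unfolding dx_def partial_def
  using DERIV_imp_deriv[OF smooth_on_DERIV[OF f assms, of "(axis i 1, 0)"]] by simp

lemma dp_DERIV:
  assumes "(x, p) \<in> S"
  shows "((\<lambda>t. f x (p + t *\<^sub>R axis i 1)) has_real_derivative dp i f x p) (at 0)"
  using smooth_on_DERIV[OF f assms, of "(0, axis i 1)"] dp_eq_frechet_derivative[OF assms] by simp

lemma dx_DERIV:
  assumes "(x, p) \<in> S"
  shows "((\<lambda>t. f (x + t *\<^sub>R axis i 1) p) has_real_derivative dx i f x p) (at 0)"
  using smooth_on_DERIV[OF f assms, of "(axis i 1, 0)"] dx_eq_frechet_derivative[OF assms] by simp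

lemma dp_direction_DERIV:
  assumes "(x, p) \<in> S"
  shows "((\<lambda>t. f x (p + t *\<^sub>R v)) has_real_derivative (\<Sum>i\<in>UNIV. dp i f x p * v $ i)) (at 0)"
proof -
  let ?D = "frechet_derivative (\<lambda>(x, p). f x p) (at (x, p))"
  have lin: "linear ?D"
    using has_derivative_linear[OF smooth_on_has_derivative[OF f assms]] .
  have "(0, v) = (\<Sum>i\<in>UNIV. v $ i *\<^sub>R (0 :: real^'n, axis i 1 :: real^'n))"
    using basis_expansion[of v] by (simp add: prod_eq_iff fst_sum snd_sum scalar_mult_eq_scaleR)
  then have "?D (0, v) = ?D (\<Sum>i\<in>UNIV. v $ i *\<^sub>R (0, axis i 1))"
    by simp
  also have "\<dots> = (\<Sum>i\<in>UNIV. dp i f x p * v $ i)"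
    unfolding linear_sum[OF lin] by (simp only: linear_cmul[OF lin] dp_eq_frechet_derivative[OF assms])
      (simp add: mult.commute)
  finally show ?thesis using smooth_on_DERIV[OF f assms, of "(0, v)"] by simp
qed

lemma smooth_on_dp:
  assumes "open S" shows "smooth_on (\<lambda>(x, p). dp i f x p) S"
  by (rule smooth_on_cong[OF assms smooth_on_frechet_derivative[OF f, of "(0, axis i 1)"]])
    (auto simp: dp_eq_frechet_derivative)

end


lemma line_avoids_zero:
  fixes p v :: "'a::real_normed_vector"
  assumes "p \<noteq> 0"
  shows "open {t. p + t *\<^sub>R v \<noteq> 0}"
  by (rule open_Collect_neq) (auto intro!: continuous_intros)

text \<open>Together with \<open>dp_direction_DERIV\<close> this makes the Hessian form at
  \<open>v\<close> the second derivative of \<open>f\<close> along a line, so that definiteness can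
  be exploited on lines.\<close>

lemma dp_dp_direction_DERIV:
  fixes f :: "'n::finite phase_fun"
  assumes "smooth_on (\<lambda>(x, p). f x p) S" "open S" "(x, p) \<in> S"
  shows "((\<lambda>t. \<Sum>i\<in>UNIV. dp i f x (p + t *\<^sub>R v) * v $ i) has_real_derivative
    (\<Sum>i\<in>UNIV. \<Sum>j\<in>UNIV. dp i (dp j f) x p * v $ i * v $ j)) (at 0)"
proof -
  have "((\<lambda>t. \<Sum>j\<in>UNIV. dp j f x (p + t *\<^sub>R v) * v $ j) has_real_derivative
      (\<Sum>j\<in>UNIV. (\<Sum>i\<in>UNIV. dp i (dp j f) x p * v $ i) * v $ j)) (at 0)"
    by (intro DERIV_sum DERIV_cmult_right
        dp_direction_DERIV[OF smooth_on_dp[OF assms(1,2)] assms(3)])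
  also have "(\<Sum>j\<in>UNIV. (\<Sum>i\<in>UNIV. dp i (dp j f) x p * v $ i) * v $ j) =
      (\<Sum>i\<in>UNIV. \<Sum>j\<in>UNIV. dp i (dp j f) x p * v $ i * v $ j)"
    unfolding sum_distrib_right by (rule sum.swap)
  finally show ?thesis .
qed

text \<open>The zero covector is excluded because the local quantities are not smooth there.\<close>

definition parity :: "real \<Rightarrow> (real^'n) set \<Rightarrow> 'n::finite phase_fun \<Rightarrow> bool" where
  "parity s U f \<longleftrightarrow> (\<forall>x\<in>U. \<forall>p. p \<noteq> 0 \<longrightarrow> f x (- p) = s * f x p)"

text \<open>When \<open>f x (- p) = s * f x p\<close> is differentiated in \<open>p\<close>, the
  chain rule on the left contributes a further sign.\<close>

lemma parity_dp:
  fixes f :: "'n::finite phase_fun" and i :: 'n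
  assumes "smooth_on (\<lambda>(x, p). f x p) (U \<times> (- {0}))" "parity s U f"
  shows "parity (- s) U (dp i f)"
  unfolding parity_def
proof (intro ballI allI impI)
  fix x p assume xp: "x \<in> U" "p \<noteq> (0 :: real^'n)"
  let ?e = "axis i 1 :: real^'n"
  \<comment> \<open>The base point is written \<open>- 0\<close> so that \<open>DERIV_mirror\<close>
    can replace \<open>t\<close> by \<open>- t\<close>.\<close>
  have "((\<lambda>t. f x (p + t *\<^sub>R ?e)) has_real_derivative dp i f x p) (at (- 0))"
    using dp_DERIV[OF assms(1), of x p i] xp by simp
  then have "((\<lambda>t. f x (p + (- t) *\<^sub>R ?e)) has_real_derivative - dp i f x p) (at 0)"
    by (rule DERIV_mirror[THEN iffD1])
  then have "((\<lambda>t. s * f x (p + (- t) *\<^sub>R ?e)) has_real_derivative s * - dp i f x p) (at 0)"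
    by (rule DERIV_cmult)
  then have "((\<lambda>t. f x (- p + t *\<^sub>R ?e)) has_real_derivative s * - dp i f x p) (at 0)"
  proof (rule has_field_derivative_transform_within_open)
    \<comment> \<open>Parity is given only at nonzero covectors, hence the restriction to those
      \<open>t\<close> for which the line misses zero.\<close>
    show "open {t. p + t *\<^sub>R - ?e \<noteq> 0}" by (rule line_avoids_zero[OF xp(2)])
    show "s * f x (p + (- t) *\<^sub>R ?e) = f x (- p + t *\<^sub>R ?e)" if "t \<in> {t. p + t *\<^sub>R - ?e \<noteq> 0}" for t
      using assms(2)[unfolded parity_def, rule_format, OF xp(1), of "p + t *\<^sub>R - ?e"] that
      by simp
  qed (use xp in simp)
  then show "dp i f x (- p) = - s * dp i f x p"
    using DERIV_imp_deriv by (simp add: dp_def partial_def)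
qed

text \<open>Here \<open>p\<close> stays fixed and the relation is differentiated in
  \<open>x\<close>, so no sign arises; openness of \<open>U\<close> keeps the relation valid along
  short segments.\<close>

lemma parity_dx:
  fixes f :: "'n::finite phase_fun" and i :: 'n
  assumes "smooth_on (\<lambda>(x, p). f x p) (U \<times> (- {0}))" "parity s U f" "open U"
  shows "parity s U (dx i f)"
  unfolding parity_def
proof (intro ballI allI impI)
  fix x p assume xp: "x \<in> U" "p \<noteq> (0 :: real^'n)"
  let ?e = "axis i 1 :: real^'n"
  have "((\<lambda>t. s * f (x + t *\<^sub>R ?e) p) has_real_derivative s * dx i f x p) (at 0)"
    using DERIV_cmult[OF dx_DERIV[OF assms(1), of x p i]] xp by simp
  then have "((\<lambda>t. f (x + t *\<^sub>R ?e) (- p)) has_real_derivative s * dx i f x p) (at 0)"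
  proof (rule has_field_derivative_transform_within_open)
    show "open ((\<lambda>t. x + t *\<^sub>R ?e) -` U)"
      by (rule open_vimage[OF assms(3)]) (auto intro!: continuous_intros)
    show "s * f (x + t *\<^sub>R ?e) p = f (x + t *\<^sub>R ?e) (- p)" if "t \<in> (\<lambda>t. x + t *\<^sub>R ?e) -` U" for t
      using assms(2)[unfolded parity_def] that xp by simp
  qed (use xp in simp)
  then show "dx i f x (- p) = s * dx i f x p"
    using DERIV_imp_deriv by (simp add: dx_def partial_def)
qed

section \<open>Homogeneous forms\<close>

lemma root_form_0: "root_form 0 b x p = b [] x"
  by (simp add: root_form_def monomial_def)

text \<open>Sorting the index lists by their first entry gives a recursion on the degree, on which
  the inductions about forms run.\<close>

lemma root_form_Suc:
  fixes b :: "'n::finite coeffs"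
  shows "root_form (Suc k) b x p = (\<Sum>i\<in>UNIV. p $ i * root_form k (\<lambda>is. b (i # is)) x p)"
proof -
  have "{is :: 'n list. length is = Suc k} = (\<lambda>(i, is). i # is) ` (UNIV \<times> {is. length is = k})"
    by (auto simp: length_Suc_conv image_iff)
  moreover have "inj_on (\<lambda>(i, is). i # is) (UNIV \<times> {is :: 'n list. length is = k})"
    by (auto simp: inj_on_def)
  ultimately have "root_form (Suc k) b x p =
      (\<Sum>(i, is)\<in>UNIV \<times> {is. length is = k}. b (i # is) x * monomial (i # is) p)"
    unfolding root_form_def by (simp add: sum.reindex case_prod_unfold)
  also have "\<dots> = (\<Sum>i\<in>UNIV. \<Sum>is | length is = k. b (i # is) x * monomial (i # is) p)"
    by (rule sum.cartesian_product[symmetric])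
  finally show ?thesis
    by (simp add: root_form_def sum_distrib_left monomial_def mult_ac)
qed

lemma root_form_cong:
  "(\<And>is. length is = k \<Longrightarrow> b is x = c is x) \<Longrightarrow> root_form k b x p = root_form k c x p"
  by (simp add: root_form_def)

lemma root_form_scale: "root_form k b x (c *\<^sub>R p) = c ^ k * root_form k b x p"
  by (induction k arbitrary: b) (simp_all add: root_form_0 root_form_Suc sum_distrib_left mult_ac)

text \<open>Split off the first index and apply the product rule. Differentiating the explicit
  factor gives the sum once; by symmetry the remaining terms reassemble into as many further copies
  as the degree of the inner form, so the total factor is the degree.\<close>

lemma root_form_direction_DERIV:
  fixes b :: "'n::finite coeffs"
  assumes "\<And>is js. length is = Suc k \<Longrightarrow> mset js = mset is \<Longrightarrow> b js x = b is x"
  shows "((\<lambda>t. root_form (Suc k) b x (p + t *\<^sub>R v)) has_real_derivative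
    (real k + 1) * (\<Sum>i\<in>UNIV. v $ i * root_form k (\<lambda>is. b (i # is)) x p)) (at 0)"
  using assms
proof (induction k arbitrary: b)
  case 0
  show ?case
    by (auto simp: root_form_Suc root_form_0 intro!: derivative_eq_intros)
next
  case (Suc k)
  let ?R = "\<lambda>i. root_form (Suc k) (\<lambda>is. b (i # is)) x"
  let ?Q = "\<lambda>i j. root_form k (\<lambda>is. b (i # j # is)) x p"
  have R: "((\<lambda>t. ?R i (p + t *\<^sub>R v)) has_real_derivative (real k + 1) * (\<Sum>j\<in>UNIV. v $ j * ?Q i j)) (at 0)"
    for i
    by (rule Suc.IH) (use Suc.prems in auto)
  have "(\<Sum>i\<in>UNIV. p $ i * (\<Sum>j\<in>UNIV. v $ j * ?Q i j)) = (\<Sum>i\<in>UNIV. \<Sum>j\<in>UNIV. v $ j * (p $ i * ?Q i j))"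
    by (simp add: sum_distrib_left mult_ac)
  also have "\<dots> = (\<Sum>j\<in>UNIV. v $ j * (\<Sum>i\<in>UNIV. p $ i * ?Q i j))"
    by (subst sum.swap) (simp add: sum_distrib_left)
  also have "\<dots> = (\<Sum>j\<in>UNIV. v $ j * (\<Sum>i\<in>UNIV. p $ i * ?Q j i))"
    by (intro sum.cong refl arg_cong2[of _ _ _ _ "(*)"] root_form_cong Suc.prems) auto
  also have "\<dots> = (\<Sum>j\<in>UNIV. v $ j * ?R j p)"
    by (simp add: root_form_Suc)
  finally have swap: "(\<Sum>i\<in>UNIV. p $ i * (\<Sum>j\<in>UNIV. v $ j * ?Q i j)) = (\<Sum>j\<in>UNIV. v $ j * ?R j p)" .
  have "((\<lambda>t. (p + t *\<^sub>R v) $ i * ?R i (p + t *\<^sub>R v)) has_real_derivative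
      v $ i * ?R i p + (real k + 1) * (p $ i * (\<Sum>j\<in>UNIV. v $ j * ?Q i j))) (at 0)" for i
    by (rule derivative_eq_intros R refl | simp)+
  then have "((\<lambda>t. \<Sum>i\<in>UNIV. (p + t *\<^sub>R v) $ i * ?R i (p + t *\<^sub>R v)) has_real_derivative
      (\<Sum>i\<in>UNIV. v $ i * ?R i p + (real k + 1) * (p $ i * (\<Sum>j\<in>UNIV. v $ j * ?Q i j)))) (at 0)"
    by (intro DERIV_sum)
  also have "(\<Sum>i\<in>UNIV. v $ i * ?R i p + (real k + 1) * (p $ i * (\<Sum>j\<in>UNIV. v $ j * ?Q i j))) =
      (real (Suc k) + 1) * (\<Sum>i\<in>UNIV. v $ i * ?R i p)"
    using swap by (simp add: sum.distrib sum_distrib_left[symmetric] algebra_simps)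
  finally show ?case by (subst root_form_Suc)
qed

lemma smooth_on_root_form:
  fixes b :: "'n::finite coeffs" and U T :: "(real^'n) set"
  assumes "open U" "open T" "\<And>is. length is = k \<Longrightarrow> smooth_on (b is) U"
  shows "smooth_on (\<lambda>(x, p). root_form k b x p) (U \<times> T)"
proof -
  have op: "open (U \<times> T)" using assms by (simp add: open_Times)
  have "smooth_on (\<lambda>z. \<Sum>is | length is = k. b is (fst z) * monomial is (snd z)) (U \<times> T)"
    unfolding monomial_def
    by (intro smooth_on_sum smooth_on_mult smooth_on_prod_list op
        smooth_on_compose_linear[OF bounded_linear_fst op _ assms(3)]
        smooth_on_linear[OF bounded_linear_compose[OF bounded_linear_vec_nth bounded_linear_snd]]) auto
  then show ?thesis by (simp add: root_form_def case_prod_unfold)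
qed


section \<open>Local m-th root Cartan metrics\<close>

text \<open>What the global hypotheses give in one chart with coordinate image \<open>U\<close>; the
  main argument then takes place over an open set of coordinates.\<close>

locale local_mth_root_metric =
  fixes U :: "(real^'n::finite) set" and m :: nat and a :: "'n coeffs" and K :: "'n phase_fun"
  assumes open_U: "open U"
    and m_ge_3: "m \<ge> 3"
    and smooth_a: "\<And>is. length is = m \<Longrightarrow> smooth_on (a is) U"
    and symmetric_a: "\<And>is js x. length is = m \<Longrightarrow> mset js = mset is \<Longrightarrow> x \<in> U \<Longrightarrow> a js x = a is x"
    and K_eq_root: "\<And>x p. x \<in> U \<Longrightarrow> K x p = root m (root_form m a x p)"
    and smooth_K: "smooth_on (\<lambda>(x, p). K x p) (U \<times> (- {0}))"
    and metric_pos: "\<And>x p v. x \<in> U \<Longrightarrow> p \<noteq> 0 \<Longrightarrow> v \<noteq> 0 \<Longrightarrow>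
      (\<Sum>i\<in>UNIV. \<Sum>j\<in>UNIV. metric_tensor K i j x p * v $ i * v $ j) > 0"
begin

abbreviation S :: "((real^'n) \<times> (real^'n)) set" where "S \<equiv> U \<times> (- {0})"

abbreviation F :: "'n phase_fun" where "F \<equiv> \<lambda>x p. (K x p)\<^sup>2"

section \<open>Nonvanishing of \<open>K\<close> and nondegeneracy of the degree \<open>m\<close>
  form\<close>

lemma open_S: "open S"
  using open_U by (simp add: open_Times open_Compl)

lemma smooth_F: "smooth_on (\<lambda>(x, p). F x p) S"
  using smooth_on_power[OF open_S smooth_K, of 2] by (simp add: case_prod_unfold)

text \<open>Squaring makes this independent of the sign of the form.\<close>

lemma F_power: "x \<in> U \<Longrightarrow> F x p ^ m = (root_form m a x p)\<^sup>2"
proof -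
  assume "x \<in> U"
  then have "\<bar>K x p\<bar> ^ m = \<bar>root_form m a x p\<bar>"
    using m_ge_3 by (simp add: K_eq_root real_root_abs[symmetric])
  then show ?thesis by (metis power2_abs power_mult mult.commute)
qed

text \<open>The factor \<open>root m (c ^ m)\<close> is \<open>c\<close> for odd \<open>m\<close>
  and \<open>\<bar>c\<bar>\<close> for even \<open>m\<close>. Left unevaluated, it covers both
  parities and every real \<open>c\<close>, including zero and negative values.\<close>

lemma K_scale: "x \<in> U \<Longrightarrow> K x (c *\<^sub>R p) = root m (c ^ m) * K x p"
  by (simp add: K_eq_root root_form_scale real_root_mult)

lemma F_second_pos:
  assumes "x \<in> U" "p \<noteq> 0" "v \<noteq> 0"
  shows "(\<Sum>i\<in>UNIV. \<Sum>j\<in>UNIV. dp i (dp j F) x p * v $ i * v $ j) > 0"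
  using metric_pos[OF assms] by (simp add: metric_tensor_def sum_divide_distrib[symmetric])

text \<open>By homogeneity a zero of \<open>K\<close> would propagate along its ray, where the Hessian of \<open>F\<close> would
  degenerate.\<close>

lemma K_nonzero:
  assumes "x \<in> U" "p \<noteq> 0" shows "K x p \<noteq> 0"
proof
  assume K0: "K x p = 0"
  have F0: "F x (c *\<^sub>R p) = 0" for c
    using K0 by (simp add: K_scale[OF assms(1)])
  have D0: "(\<Sum>i\<in>UNIV. dp i F x (p + s *\<^sub>R p) * p $ i) = 0" if "p + s *\<^sub>R p \<noteq> 0" for s
  proof -
    have "((\<lambda>t. F x (p + s *\<^sub>R p + t *\<^sub>R p)) has_real_derivative
        (\<Sum>i\<in>UNIV. dp i F x (p + s *\<^sub>R p) * p $ i)) (at 0)"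
      by (rule dp_direction_DERIV[OF smooth_F]) (use assms that in simp)
    moreover have "F x (p + s *\<^sub>R p + t *\<^sub>R p) = 0" for t
      using F0[of "1 + s + t"] by (simp add: algebra_simps)
    ultimately show ?thesis
      using DERIV_unique[OF _ DERIV_const[of 0]] by simp
  qed
  have "((\<lambda>s. \<Sum>i\<in>UNIV. dp i F x (p + s *\<^sub>R p) * p $ i) has_real_derivative
      (\<Sum>i\<in>UNIV. \<Sum>j\<in>UNIV. dp i (dp j F) x p * p $ i * p $ j)) (at 0)"
    by (rule dp_dp_direction_DERIV[OF smooth_F open_S]) (use assms in simp)
  from has_field_derivative_transform_within_open[OF this line_avoids_zero[OF assms(2), of p], of "\<lambda>_. 0"]
  have "((\<lambda>_. 0) has_real_derivative
      (\<Sum>i\<in>UNIV. \<Sum>j\<in>UNIV. dp i (dp j F) x p * p $ i * p $ j)) (at 0)"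
    using D0 assms(2) by simp
  from DERIV_unique[OF this DERIV_const] F_second_pos[OF assms(1,2,2)] show False by simp
qed

text \<open>If \<open>v\<close> is in the kernel of the Hessian of the form \<open>A\<close> then by homogeneity \<open>A\<close> also has
  vanishing derivative along \<open>v\<close>; differentiating \<open>F ^ m = A\<^sup>2\<close> twice along \<open>v\<close> then shows that the
  Hessian of \<open>F\<close> vanishes on \<open>v\<close>.\<close>

lemma form_nondegenerate:
  assumes x: "x \<in> U" and p: "p \<noteq> 0"
    and ker: "\<And>i. (\<Sum>j\<in>UNIV. root_form (m - 2) (\<lambda>is. a (i # j # is)) x p * v $ j) = 0"
  shows "v = 0"
proof (rule ccontr)
  assume v: "v \<noteq> 0"
  obtain k where m: "m = Suc (Suc k)"
    using m_ge_3 by (metis add_2_eq_Suc le_Suc_ex numeral_3_eq_3 add_Suc)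
  define A where "A = root_form m a x"
  define A1 where "A1 q = real m * (\<Sum>i\<in>UNIV. v $ i * root_form (Suc k) (\<lambda>is. a (i # is)) x q)" for q
  define F1 where "F1 q = (\<Sum>i\<in>UNIV. dp i F x q * v $ i)" for q
  let ?R = "\<lambda>i j. root_form k (\<lambda>is. a (i # j # is)) x p"
  let ?P = "\<Sum>i\<in>UNIV. \<Sum>j\<in>UNIV. dp i (dp j F) x p * v $ i * v $ j"
  have ker': "(\<Sum>j\<in>UNIV. v $ j * ?R i j) = 0" for i
    using ker[of i] by (simp add: m mult.commute)
  have A: "((\<lambda>t. A (q + t *\<^sub>R v)) has_real_derivative A1 q) (at 0)" for q
    using root_form_direction_DERIV[of "Suc k" a x q v, OF symmetric_a[OF _ _ x]]
    unfolding A_def A1_def m by (simp add: add.commute)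
  have "((\<lambda>t. root_form (Suc k) (\<lambda>is. a (i # is)) x (p + t *\<^sub>R v)) has_real_derivative
      (real k + 1) * (\<Sum>j\<in>UNIV. v $ j * ?R i j)) (at 0)" for i
    by (rule root_form_direction_DERIV) (rule symmetric_a[OF _ _ x], auto simp: m)
  then have "((\<lambda>t. root_form (Suc k) (\<lambda>is. a (i # is)) x (p + t *\<^sub>R v)) has_real_derivative 0) (at 0)" for i
    by (simp add: ker')
  then have A1: "((\<lambda>t. A1 (p + t *\<^sub>R v)) has_real_derivative 0) (at 0)"
    unfolding A1_def by (auto intro!: derivative_eq_intros)
  have "A1 p = real m * (\<Sum>i\<in>UNIV. \<Sum>j\<in>UNIV. p $ j * (v $ i * ?R i j))"
    by (simp add: A1_def root_form_Suc sum_distrib_left mult_ac)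
  also have "\<dots> = real m * (\<Sum>j\<in>UNIV. p $ j * (\<Sum>i\<in>UNIV. v $ i * ?R i j))"
    by (subst sum.swap) (simp add: sum_distrib_left)
  \<comment> \<open>Symmetry of \<open>a\<close> exchanges the two indices, so that the inner sum
    becomes the kernel equation.\<close>
  also have "\<dots> = real m * (\<Sum>j\<in>UNIV. p $ j * (\<Sum>i\<in>UNIV. v $ i * ?R j i))"
    by (intro sum.cong refl arg_cong2[of _ _ _ _ "(*)"] root_form_cong symmetric_a[OF _ _ x])
      (auto simp: m)
  also have "\<dots> = 0" by (simp add: ker')
  finally have A1_0: "A1 p = 0" .
  have F: "((\<lambda>t. F x (q + t *\<^sub>R v)) has_real_derivative F1 q) (at 0)" if "q \<noteq> 0" for q
    unfolding F1_def by (rule dp_direction_DERIV[OF smooth_F]) (use x that in simp)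
  have F1: "((\<lambda>t. F1 (p + t *\<^sub>R v)) has_real_derivative ?P) (at 0)"
    unfolding F1_def by (rule dp_dp_direction_DERIV[OF smooth_F open_S]) (use x p in simp)
  \<comment> \<open>Both sides are the derivative along \<open>v\<close> of \<open>F ^ m\<close>,
    which equals the square of \<open>A\<close>. The identity is stated at every nonzero
    \<open>q\<close> because it is differentiated once more at \<open>p\<close>.\<close>
  have eq: "real m * F x q ^ (m - 1) * F1 q = 2 * A q * A1 q" if "q \<noteq> 0" for q
  proof (rule DERIV_unique)
    show "((\<lambda>t. F x (q + t *\<^sub>R v) ^ m) has_real_derivative real m * F x q ^ (m - 1) * F1 q) (at 0)"
      by (rule derivative_eq_intros F[OF that] refl | simp)+
    have "((\<lambda>t. (A (q + t *\<^sub>R v))\<^sup>2) has_real_derivative 2 * A q * A1 q) (at 0)"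
      by (rule derivative_eq_intros A refl | simp)+
    then show "((\<lambda>t. F x (q + t *\<^sub>R v) ^ m) has_real_derivative 2 * A q * A1 q) (at 0)"
      by (simp add: F_power[OF x] A_def)
  qed
  have Fp: "F x p > 0" using K_nonzero[OF x p] by simp
  have F1_0: "F1 p = 0"
    using eq[OF p] A1_0 Fp m by auto
  \<comment> \<open>Since \<open>F1 p = 0\<close>, the product-rule term containing the derivative
    of \<open>F ^ (m - 1)\<close> drops out.\<close>
  have "((\<lambda>t. real m * F x (p + t *\<^sub>R v) ^ (m - 1) * F1 (p + t *\<^sub>R v)) has_real_derivative
      real m * F x p ^ (m - 1) * ?P) (at 0)"
    by (rule derivative_eq_intros F[OF p] F1 refl | simp add: F1_0)+
  then have "((\<lambda>t. 2 * A (p + t *\<^sub>R v) * A1 (p + t *\<^sub>R v)) has_real_derivative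
      real m * F x p ^ (m - 1) * ?P) (at 0)"
    by (rule has_field_derivative_transform_within_open[OF _ line_avoids_zero[OF p, of v]])
      (use p eq in auto)
  \<comment> \<open>Both product-rule terms vanish: \<open>A1 p = 0\<close>, and the derivative of
    \<open>A1\<close> along \<open>v\<close> at \<open>p\<close> is zero.\<close>
  moreover have "((\<lambda>t. 2 * A (p + t *\<^sub>R v) * A1 (p + t *\<^sub>R v)) has_real_derivative 0) (at 0)"
    by (rule derivative_eq_intros A A1 refl | simp add: A1_0)+
  ultimately have "real m * F x p ^ (m - 1) * ?P = 0"
    by (rule DERIV_unique)
  moreover have "real m * F x p ^ (m - 1) * ?P > 0"
    using F_second_pos[OF x p v] Fp m_ge_3 by (intro mult_pos_pos) auto
  ultimately show False by linarith
qed

section \<open>Solvability of the spray equations and smoothness of the spray\<close>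

definition spray_matrix :: "real^'n \<Rightarrow> real^'n \<Rightarrow> real^'n^'n" where
  "spray_matrix x p = (\<chi> h r. a2 m a K h r x p)"

definition spray_rhs :: "'n \<Rightarrow> 'n phase_fun" where
  "spray_rhs h x p = 1 / (real m * K x p ^ (m - 2)) * christoffel0 m a h x p"

lemma a2_eq: "a2 m a K i j x p = inverse (K x p ^ (m - 2)) * root_form (m - 2) (\<lambda>is. a (i # j # is)) x p"
  by (simp add: a2_def root_form_def)

lemma christoffel0_eq: "christoffel0 m a h = root_form m (\<lambda>is. christoffel m a is h)"
  by (intro ext) (simp add: christoffel0_def root_form_def)

text \<open>Up to a nonzero power of \<open>K\<close>, the matrix contracts the coefficients with
  \<open>m - 2\<close> copies of \<open>p\<close>, so \<open>form_nondegenerate\<close> excludes a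
  nonzero kernel vector.\<close>

lemma det_spray_matrix_nonzero:
  assumes "x \<in> U" "p \<noteq> 0" shows "det (spray_matrix x p) \<noteq> 0"
proof -
  have "v = 0" if "spray_matrix x p *v v = 0" for v
  proof (rule form_nondegenerate[OF assms])
    fix i
    have "(\<Sum>j\<in>UNIV. a2 m a K i j x p * v $ j) = 0"
      using arg_cong[OF that, of "\<lambda>w. w $ i"] by (simp add: matrix_vector_mult_def spray_matrix_def)
    then show "(\<Sum>j\<in>UNIV. root_form (m - 2) (\<lambda>is. a (i # j # is)) x p * v $ j) = 0"
      using K_nonzero[OF assms] by (simp add: a2_eq mult.assoc sum_distrib_left[symmetric])
  qed
  then show ?thesis
    using matrix_left_invertible_ker[of "spray_matrix x p"] invertible_left_inverse invertible_det_nz by blast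
qed

text \<open>The nonzero determinant makes the solution described by \<open>THE\<close> exist
  uniquely. Written as a quotient of determinants, it is visibly smooth in
  \<open>(x, p)\<close>.\<close>

lemma G0_cramer:
  assumes "x \<in> U" "p \<noteq> 0"
  shows "G0 m a K r x p =
    det (\<chi> i j. if j = r then spray_rhs i x p else spray_matrix x p $ i $ j) / det (spray_matrix x p)"
proof -
  have "(\<forall>h. (\<Sum>r\<in>UNIV. a2 m a K h r x p * G $ r) = spray_rhs h x p) \<longleftrightarrow>
      spray_matrix x p *v G = (\<chi> h. spray_rhs h x p)" for G
    by (simp add: vec_eq_iff matrix_vector_mult_def spray_matrix_def)
  then show ?thesis
    by (simp only: G0_def spray_def spray_rhs_def[symmetric]
        cramer[OF det_spray_matrix_nonzero[OF assms]])
      (simp cong: if_cong)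
qed

lemma smooth_christoffel:
  assumes "length is = m" shows "smooth_on (christoffel m a is h) U"
  unfolding christoffel_def
  by (intro smooth_on_mult smooth_on_diff smooth_on_sum smooth_on_const smooth_on_partial
      smooth_a open_U) (use assms m_ge_3 in auto)

lemma smooth_a2: "smooth_on (\<lambda>(x, p). a2 m a K i j x p) S"
proof -
  have "smooth_on (\<lambda>z. inverse ((\<lambda>(x, p). K x p) z ^ (m - 2)) *
      (\<lambda>(x, p). root_form (m - 2) (\<lambda>is. a (i # j # is)) x p) z) S"
    by (intro smooth_on_mult smooth_on_inverse smooth_on_power open_S smooth_K smooth_on_root_form
        open_U smooth_a) (use m_ge_3 K_nonzero in \<open>auto simp: open_Compl\<close>)
  then show ?thesis by (simp add: a2_eq case_prod_unfold)
qed

lemma smooth_spray_rhs: "smooth_on (\<lambda>(x, p). spray_rhs h x p) S"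
proof -
  have "smooth_on (\<lambda>z. 1 / (real m * (\<lambda>(x, p). K x p) z ^ (m - 2)) *
      (\<lambda>(x, p). root_form m (\<lambda>is. christoffel m a is h) x p) z) S"
    by (intro smooth_on_mult smooth_on_divide smooth_on_const smooth_on_power open_S smooth_K
        smooth_on_root_form open_U smooth_christoffel)
      (use m_ge_3 K_nonzero in \<open>auto simp: open_Compl\<close>)
  then show ?thesis by (simp add: spray_rhs_def christoffel0_eq case_prod_unfold)
qed

lemma smooth_G0: "smooth_on (\<lambda>(x, p). G0 m a K r x p) S"
proof (rule smooth_on_cong[OF open_S])
  have B: "smooth_on (\<lambda>z. spray_matrix (fst z) (snd z) $ i $ j) S" for i j
    using smooth_a2[of i j] by (simp add: spray_matrix_def case_prod_unfold)
  have "smooth_on (\<lambda>z. if j = r then spray_rhs i (fst z) (snd z)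
      else spray_matrix (fst z) (snd z) $ i $ j) S" for i j
    using B smooth_spray_rhs[of i] by (cases "j = r") (simp_all add: case_prod_unfold)
  then show "smooth_on (\<lambda>z. det (\<chi> i j. if j = r then spray_rhs i (fst z) (snd z)
      else spray_matrix (fst z) (snd z) $ i $ j) / det (spray_matrix (fst z) (snd z))) S"
    by (intro smooth_on_divide smooth_on_det open_S B) (use det_spray_matrix_nonzero in auto)
qed (simp add: mem_Times_iff case_prod_unfold G0_cramer cong: if_cong)

lemma smooth_G1: "smooth_on (\<lambda>(x, p). G1 m a K r i x p) S"
  unfolding G1_def by (rule smooth_on_dp[OF smooth_G0 open_S])

lemma smooth_G2: "smooth_on (\<lambda>(x, p). G2 m a K r i j x p) S"
  unfolding G2_def by (rule smooth_on_dp[OF smooth_G1 open_S])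

lemma smooth_G3: "smooth_on (\<lambda>(x, p). G3 m a K r i j k x p) S"
  unfolding G3_def by (rule smooth_on_dp[OF smooth_G2 open_S])

lemma smooth_mean_berwald: "smooth_on (\<lambda>(x, p). mean_berwald m a K i j x p) S"
proof -
  have "smooth_on (\<lambda>z. 1 / 2 * (\<Sum>r\<in>UNIV. (\<lambda>(x, p). G3 m a K r r i j x p) z)) S"
    by (intro smooth_on_mult smooth_on_const smooth_on_sum open_S smooth_G3)
  then show ?thesis by (simp add: mean_berwald_def case_prod_unfold)
qed

section \<open>Parity of the spray and of the curvatures\<close>

lemma K_minus: "x \<in> U \<Longrightarrow> K x (- p) = (- 1) ^ m * K x p"
  using K_scale[of x "- 1" p] by (cases "even m") (use m_ge_3 in \<open>auto simp: real_root_minus\<close>)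

text \<open>The linear system for the spray is the same at \<open>p\<close> and \<open>- p\<close>.
  The signs of \<open>K ^ (m - 2)\<close> and of the forms combine to the exponents
  \<open>(m - 2) * (m + 1)\<close> for the matrix and \<open>m * (m - 1)\<close> for the right-hand
  side, both even.\<close>

lemma spray_even:
  assumes "x \<in> U" shows "spray m a K x (- p) = spray m a K x p"
proof -
  have form: "root_form k b x (- p) = (- 1) ^ k * root_form k b x p" for k b
    using root_form_scale[of k b x "- 1" p] by simp
  have "a2 m a K h r x (- p) = a2 m a K h r x p" for h r
    by (cases "even m") (use m_ge_3 in \<open>simp_all add: a2_eq form K_minus[OF assms]\<close>)
  moreover have "spray_rhs h x (- p) = spray_rhs h x p" for h
    by (cases "even m")
      (use m_ge_3 in \<open>simp_all add: spray_rhs_def christoffel0_eq form K_minus[OF assms]\<close>)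
  ultimately show ?thesis by (simp only: spray_def spray_rhs_def[symmetric])
qed

lemma parity_G0: "parity 1 U (G0 m a K r)"
  by (simp add: parity_def G0_def spray_even)

lemma parity_G1: "parity (- 1) U (G1 m a K r i)"
  unfolding G1_def by (rule parity_dp[OF smooth_G0 parity_G0])

lemma parity_G2: "parity 1 U (G2 m a K r i j)"
  unfolding G2_def using parity_dp[OF smooth_G1 parity_G1] by simp

lemma parity_G3: "parity (- 1) U (G3 m a K r i j k)"
  unfolding G3_def by (rule parity_dp[OF smooth_G2 parity_G2])

lemma parity_mean_berwald: "parity (- 1) U (mean_berwald m a K i j)"
  using parity_G3 by (simp add: parity_def mean_berwald_def sum_negf)

text \<open>Every term of the covariant derivative is odd: the \<open>x\<close>-derivative of
  \<open>E\<close> directly, the others as products of an odd and an even factor. Contraction with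
  \<open>p\<close> supplies the second sign.\<close>

lemma H_curvature_even:
  assumes "x \<in> U" "p \<noteq> 0"
  shows "H_curvature m a K i j x (- p) = H_curvature m a K i j x p"
proof -
  note flip = parity_def[THEN iffD1, rule_format, OF _ assms]
  have "mean_berwald_cov m a K i j s x (- p) = - mean_berwald_cov m a K i j s x p" for s
    using flip[OF parity_dx[OF smooth_mean_berwald parity_mean_berwald open_U]]
      flip[OF parity_dp[OF smooth_mean_berwald parity_mean_berwald]]
      flip[OF parity_mean_berwald] flip[OF parity_G1] flip[OF parity_G2]
    by (simp add: mean_berwald_cov_def sum_negf)
  then show ?thesis by (simp add: H_curvature_def)
qed

section \<open>The angular metric for even and for odd \<open>m\<close>, and the conclusion in a
  chart\<close>

lemma angular_metric_even:
  assumes "even m" "x \<in> U" "p \<noteq> 0"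
  shows "angular_metric K i j x (- p) = angular_metric K i j x p"
proof -
  have "parity 1 U K"
    using assms(1) K_minus by (simp add: parity_def)
  from parity_dp[OF smooth_on_dp[OF smooth_K open_S] parity_dp[OF smooth_K this]]
  show ?thesis using assms K_minus by (simp add: parity_def angular_metric_def)
qed

text \<open>For odd \<open>m\<close>, \<open>K\<close> takes opposite values at \<open>p\<close> and
  \<open>- p\<close>. On a connected punctured fibre it would then have a zero, contrary to
  \<open>K_nonzero\<close>.\<close>

lemma odd_degree_imp_dim_1:
  assumes "odd m" "x \<in> U" shows "CARD('n) = 1"
proof (rule ccontr)
  assume "CARD('n) \<noteq> 1"
  then have "2 \<le> CARD('n)"
    using zero_less_card_finite[where 'a = 'n] by linarith
  then have conn: "connected (- {0 :: real^'n})"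
    using connected_punctured_universe[of "0 :: real^'n"] by simp
  have "continuous_on S (\<lambda>(x, p). K x p)"
    using smooth_K unfolding smooth_on_def by (metis k_times_differentiable_on.simps(1))
  moreover have "continuous_on (- {0 :: real^'n}) (\<lambda>p. (x, p))"
    by (intro continuous_intros)
  ultimately have "continuous_on (- {0}) (K x)"
    using continuous_on_compose2[of S "\<lambda>(x, p). K x p" "- {0}" "\<lambda>p. (x, p)"] assms(2) by auto
  then have conn: "connected (K x ` (- {0}))"
    using conn by (rule connected_continuous_image)
  let ?p = "axis undefined 1 :: real^'n"
  have p: "?p \<noteq> 0" by (simp add: axis_eq_0_iff)
  then have "K x ?p \<in> K x ` (- {0})" "- K x ?p \<in> K x ` (- {0})"
    using K_minus[OF assms(2), of ?p] assms(1) by (auto intro!: image_eqI[of _ _ "- ?p"])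
  moreover have "0 \<in> closed_segment (K x ?p) (- K x ?p)"
    by (auto simp: closed_segment_eq_real_ivl)
  ultimately have "0 \<in> K x ` (- {0})"
    using conn connected_contains_Icc[of "K x ` (- {0})"] unfolding closed_segment_eq_real_ivl
    by (metis (no_types, lifting) subsetD)
  then show False using K_nonzero[OF assms(2)] by (metis ComplD image_iff singletonI)
qed

text \<open>With a single index and odd \<open>m\<close>, \<open>root m (s ^ m) = s\<close> makes
  \<open>K\<close> linear on the whole fibre, so \<open>dp j K\<close> is constant in
  \<open>p\<close> and its derivative vanishes.\<close>

lemma odd_degree_imp_angular_metric_0:
  assumes "odd m" "x \<in> U" shows "angular_metric K i j x p = 0"
proof -
  obtain e :: 'n where e: "\<And>i. i = e"
    using odd_degree_imp_dim_1[OF assms] by (metis card_1_singletonE singletonD UNIV_I)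
  have K: "K x q = q $ e * K x (axis e 1)" for q
  proof -
    have "q = (q $ e) *\<^sub>R axis e 1" by (simp add: vec_eq_iff axis_def) (metis e)
    then have "K x q = root m ((q $ e) ^ m) * K x (axis e 1)"
      using K_scale[OF assms(2)] by metis
    then show ?thesis by (simp add: odd_real_root_power_cancel assms(1))
  qed
  have "K x (q + t *\<^sub>R axis j 1) = (q $ e + t) * K x (axis e 1)" for q t
    using K[of "q + t *\<^sub>R axis j 1"] by (simp add: e[of j])
  moreover have "((\<lambda>t. (q $ e + t) * K x (axis e 1)) has_real_derivative K x (axis e 1)) (at 0)" for q
    by (auto intro!: derivative_eq_intros)
  ultimately have "dp j K x q = K x (axis e 1)" for q
    by (simp add: dp_def partial_def DERIV_imp_deriv)
  then show ?thesis by (simp add: angular_metric_def dp_def[of i "dp j K"] partial_def)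
qed

text \<open>Here \<open>t\<close> holds the components of the 1-form at the fixed point
  \<open>x\<close>, and \<open>c\<close> absorbs the dimensional constant. For even \<open>m\<close>
  the hypothesis at \<open>p\<close> and at \<open>- p\<close> makes the curvature odd as well as
  even; for odd \<open>m\<close> its right-hand side is zero.\<close>

lemma H_curvature_zero:
  fixes t :: "'n \<Rightarrow> real"
  assumes "x \<in> U" "p \<noteq> 0"
    and H: "\<And>p. p \<noteq> 0 \<Longrightarrow>
      H_curvature m a K i j x p = c * inverse (K x p) * (\<Sum>i\<in>UNIV. t i * p $ i) * angular_metric K i j x p"
  shows "H_curvature m a K i j x p = 0"
proof (cases "even m")
  case True
  have "H_curvature m a K i j x p = - H_curvature m a K i j x (- p)"
    using H[OF assms(2)] H[of "- p"] assms(2) angular_metric_even[OF True assms(1,2)]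
      K_minus[OF assms(1)] True by (simp add: sum_negf)
  then show ?thesis using H_curvature_even[OF assms(1,2)] by simp
next
  case False
  then show ?thesis using H[OF assms(2)] odd_degree_imp_angular_metric_0[OF _ assms(1)] by simp
qed

end

section \<open>Reduction to a single chart\<close>

theorem theorem1p4:
  fixes M :: "'a topology" and \<A> :: "('a, 'n::finite) chart set"
    and K :: "('a, 'n) covector \<Rightarrow> real" and m :: nat
    and a :: "('a, 'n) chart \<Rightarrow> 'n coeffs"
  assumes "mth_root_cartan_space M \<A> K m a"
    and "almost_vanishing_H_curvature M \<A> K m a"
  shows "vanishing_H_curvature M \<A> K m a"
  unfolding vanishing_H_curvature_def
proof (intro ballI allI impI)
  fix c x p i j
  assume c: "c \<in> \<A>" and x: "x \<in> snd c ` fst c" and p: "p \<noteq> (0 :: real^'n)"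
  interpret local_mth_root_metric "snd c ` fst c" m "a c" "in_chart M \<A> c K"
  proof
    note root = assms(1)[unfolded mth_root_cartan_space_def]
    note coeffs = root[THEN conjunct2, THEN conjunct2, THEN bspec, OF c]
    note cartan = root[THEN conjunct1, unfolded cartan_space_def]
    note atlas = cartan[THEN conjunct1, unfolded smooth_manifold_def smooth_atlas_def]
    show "open (snd c ` fst c)"
      using atlas[THEN conjunct2, THEN conjunct2, THEN conjunct1] c by blast
    show "m \<ge> 3"
      using root[THEN conjunct2] by (rule conjunct1)
    show "smooth_on (\<lambda>(x, p). in_chart M \<A> c K x p) (snd c ` fst c \<times> - {0})"
      using cartan[THEN conjunct2, THEN conjunct2, THEN conjunct1] c by (rule bspec)
    show "smooth_on (a c is) (snd c ` fst c)" if "length is = m" for "is"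
      using coeffs[THEN conjunct1] that by blast
    show "a c js x = a c is x"
      if "length is = m" "mset js = mset is" "x \<in> snd c ` fst c" for "is" js x
      using coeffs[THEN conjunct2, THEN conjunct1] that by blast
    show "in_chart M \<A> c K x p = root m (root_form m (a c) x p)" if "x \<in> snd c ` fst c" for x p
      using coeffs[THEN conjunct2, THEN conjunct2] that by blast
    show "0 < (\<Sum>i\<in>UNIV. \<Sum>j\<in>UNIV. metric_tensor (in_chart M \<A> c K) i j x p * v $ i * v $ j)"
      if "x \<in> snd c ` fst c" "p \<noteq> 0" "v \<noteq> 0" for x p v
      using cartan[THEN conjunct2, THEN conjunct2, THEN conjunct2, THEN conjunct2, THEN conjunct2] c that
      by blast
  qed
  from assms(2) obtain \<theta> where \<theta>: "one_form M \<A> \<theta>"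
    and H: "\<And>p i j. p \<noteq> 0 \<Longrightarrow> H_curvature m (a c) (in_chart M \<A> c K) i j x p =
      (real CARD('n) + 1) / 2 * inverse (in_chart M \<A> c K x p) * in_chart M \<A> c \<theta> x p *
      angular_metric (in_chart M \<A> c K) i j x p"
    unfolding almost_vanishing_H_curvature_def using c x by blast
  \<comment> \<open>The components depend on \<open>x\<close> alone, so the same \<open>t\<close>
    serves \<open>p\<close> and \<open>- p\<close>, as the parity argument requires.\<close>
  obtain t :: "'n \<Rightarrow> real^'n \<Rightarrow> real"
    where t: "\<And>p. in_chart M \<A> c \<theta> x p = (\<Sum>i\<in>UNIV. t i x * p $ i)"
    using \<theta> c x unfolding one_form_def by blast
  show "H_curvature m (a c) (in_chart M \<A> c K) i j x p = 0"
    by (rule H_curvature_zero[OF x p H[unfolded t]])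
qed

end
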